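(* Let $\Omega=\{\rho_k\}$ be a finite nonempty set of qubit states (density matrices on $\mathbb{C}^2$), and let $A_i,A_j$ be two binary qubit POVMs, i.e. for $l\in\{i,j\}$ $$A_l=s'_l\,\vec a_l\cdot\vec\sigma+s_l\,\mathbb{I},\qquad \vec a_l\in\mathbb{R}^3,\ |\vec a_l|=1,\quad 0\le s'_l\le 1,\quad -1\le s_l\le 1,\quad s'_l+|s_l|\le 1,$$ where $\vec\sigma=(\sigma_x,\sigma_y,\sigma_z)$ is the vector of Pauli matrices. Put $A_{l|\rho_k}:=\operatorname{Tr}(\rho_k A_l)$ for $l\in\{i,j\}$ and $\rho_k\in\Omega$. Then there exist real numbers $r_i,r_j$ with $-1\le r_i,r_j\le 1$ such that, with $\bar r_l:=1-|r_l|$, one has $\bar r_l^{\,2}-(A_{l|\rho_k}-r_l)^2\ge 0$ for all $l\in\{i,j\}$ and $\rho_k\in\Omega$, and $$\max_{\rho_k\in\Omega} g^{(\tilde\theta_4)}_-(A_{i|\rho_k},A_{j|\rho_k})\ \le\ \min_{\rho_k\in\Omega} g^{(\tilde\theta_4)}_+(A_{i|\rho_k},A_{j|\rho_k}),$$ where $\tilde\theta_4=\{r_i,r_j,\bar r_i,\bar r_j\}$ and $$g^{(\tilde\theta_4)}_\pm(u,v):=(u-r_i)(v-r_j)\pm\sqrt{\bar r_i^{\,2}-(u-r_i)^2}\,\sqrt{\bar r_j^{\,2}-(v-r_j)^2}.$$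
   Context: Prepare-and-measure scenario without public randomness (independent devices): a source prepares a qubit state $\rho_k$ from a fixed set $\Omega$, and a measurement device performs one of a fixed set of measurements; there is no run-to-run mixing, so the observed expectation values are exactly $A_{l|\rho_k}=\operatorname{Tr}(\rho_k A_l)$ for one fixed choice of states and measurements, with each measurement operator the same for all $\rho_k\in\Omega$. A binary measurement is represented by its observable $A_l$, with the two outcomes described by the positive operators $(\mathbb{I}\pm A_l)/2$. *)

theory Defs
  imports "HOL-Analysis.Analysis"
begin

definition hermitian :: "complex^'n^'n \<Rightarrow> bool" where
  "hermitian M \<longleftrightarrow> (\<forall>i j. M $ i $ j = cnj (M $ j $ i))"

definition positive_operator :: "complex^'n^'n \<Rightarrow> bool" where
  "positive_operator M \<longleftrightarrow>
     hermitian M \<and> (\<forall>v :: complex^'n. 0 \<le> Re (\<Sum>i\<in>UNIV. cnj (v $ i) * (M *v v) $ i))"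

definition density_matrix :: "complex^'n^'n \<Rightarrow> bool" where
  "density_matrix \<rho> \<longleftrightarrow> positive_operator \<rho> \<and> trace \<rho> = 1"

definition sigma_x :: "complex^2^2" where
  "sigma_x = vector [vector [0, 1], vector [1, 0]]"

definition sigma_y :: "complex^2^2" where
  "sigma_y = vector [vector [0, - \<i>], vector [\<i>, 0]]"

definition sigma_z :: "complex^2^2" where
  "sigma_z = vector [vector [1, 0], vector [0, -1]]"

definition dot_sigma :: "real^3 \<Rightarrow> complex^2^2" where
  "dot_sigma a = (a $ 1) *\<^sub>R sigma_x + (a $ 2) *\<^sub>R sigma_y + (a $ 3) *\<^sub>R sigma_z"

text \<open>Binary qubit POVMs are given by their observable \<open>A\<close>; the effects of the two outcomes
  are \<open>(I + A)/2\<close> and \<open>(I - A)/2\<close>, see \<open>binary_qubit_povm_effects\<close> below.\<close>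

definition binary_qubit_povm :: "complex^2^2 \<Rightarrow> bool" where
  "binary_qubit_povm A \<longleftrightarrow>
     (\<exists>(s' :: real) (a :: real^3) (s :: real).
        A = s' *\<^sub>R dot_sigma a + s *\<^sub>R mat 1 \<and> norm a = 1 \<and>
        0 \<le> s' \<and> s' \<le> 1 \<and> -1 \<le> s \<and> s \<le> 1 \<and> s' + \<bar>s\<bar> \<le> 1)"

text \<open>The trace is real whenever both matrices are Hermitian, see \<open>trace_eq_expectation\<close> below,
  so taking the real part loses nothing.\<close>

definition expectation :: "complex^'n^'n \<Rightarrow> complex^'n^'n \<Rightarrow> real" where
  "expectation \<rho> A = Re (trace (\<rho> ** A))"

text \<open>The parameter set \<open>\<theta>\<close> is passed as the four arguments \<open>ri rj bi bj\<close>, with \<open>bi\<close>, \<open>bj\<close>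
  standing for \<open>1 - \<bar>ri\<bar>\<close>, \<open>1 - \<bar>rj\<bar>\<close>.\<close>

definition g_minus :: "real \<Rightarrow> real \<Rightarrow> real \<Rightarrow> real \<Rightarrow> real \<Rightarrow> real \<Rightarrow> real" where
  "g_minus ri rj bi bj u v =
     (u - ri) * (v - rj) - sqrt (bi\<^sup>2 - (u - ri)\<^sup>2) * sqrt (bj\<^sup>2 - (v - rj)\<^sup>2)"

definition g_plus :: "real \<Rightarrow> real \<Rightarrow> real \<Rightarrow> real \<Rightarrow> real \<Rightarrow> real \<Rightarrow> real" where
  "g_plus ri rj bi bj u v =
     (u - ri) * (v - rj) + sqrt (bi\<^sup>2 - (u - ri)\<^sup>2) * sqrt (bj\<^sup>2 - (v - rj)\<^sup>2)"

lemma trace_eq_expectation: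
  fixes \<rho> A :: "complex^'n^'n"
  assumes "hermitian \<rho>" "hermitian A"
  shows "trace (\<rho> ** A) = complex_of_real (expectation \<rho> A)"
proof -
  have h: "cnj (\<rho> $ i $ j) = \<rho> $ j $ i" "cnj (A $ i $ j) = A $ j $ i" for i j
    using assms unfolding hermitian_def by metis+
  have "cnj (trace (\<rho> ** A)) = (\<Sum>i\<in>UNIV. \<Sum>k\<in>UNIV. \<rho> $ k $ i * A $ i $ k)"
    by (simp add: trace_def matrix_matrix_mult_def h)
  also have "\<dots> = trace (\<rho> ** A)"
    unfolding trace_def matrix_matrix_mult_def by (simp, rule sum.swap)
  finally have "trace (\<rho> ** A) \<in> \<real>"
    by (simp add: Reals_cnj_iff)
  then show ?thesis
    by (simp add: expectation_def)
qed

lemma hermitian_qubit_decomposition: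
  assumes "hermitian (A :: complex^2^2)"
  obtains t x y z :: real where "A = dot_sigma (vector [x, y, z]) + t *\<^sub>R mat 1"
proof -
  have h: "A $ 1 $ 1 = cnj (A $ 1 $ 1)" "A $ 2 $ 2 = cnj (A $ 2 $ 2)" "A $ 1 $ 2 = cnj (A $ 2 $ 1)"
    using assms unfolding hermitian_def by metis+
  have "A = dot_sigma (vector [Re (A $ 2 $ 1), Im (A $ 2 $ 1), (Re (A $ 1 $ 1) - Re (A $ 2 $ 2)) / 2])
      + ((Re (A $ 1 $ 1) + Re (A $ 2 $ 2)) / 2) *\<^sub>R mat 1"
    using h by (auto simp: vec_eq_iff forall_2 dot_sigma_def sigma_x_def sigma_y_def sigma_z_def
        mat_def complex_eq_iff field_simps)
  then show ?thesis
    using that by blast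
qed

lemma qubit_quadratic_form:
  "Re (\<Sum>i\<in>UNIV. cnj (v $ i) * ((dot_sigma (vector [x, y, z]) + t *\<^sub>R mat 1) *v v) $ i) =
     (t + z) * ((Re (v $ 1))\<^sup>2 + (Im (v $ 1))\<^sup>2) + (t - z) * ((Re (v $ 2))\<^sup>2 + (Im (v $ 2))\<^sup>2)
     + 2 * x * (Re (v $ 1) * Re (v $ 2) + Im (v $ 1) * Im (v $ 2))
     + 2 * y * (Re (v $ 1) * Im (v $ 2) - Im (v $ 1) * Re (v $ 2))"
  by (simp add: sum_2 matrix_vector_mult_def dot_sigma_def sigma_x_def sigma_y_def sigma_z_def
      mat_def algebra_simps power2_eq_square)

lemma positive_operator_qubit_iff:
  fixes x y z t :: real
  shows "positive_operator (dot_sigma (vector [x, y, z]) + t *\<^sub>R mat 1) \<longleftrightarrow>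
     norm (vector [x, y, z] :: real^3) \<le> t" (is "positive_operator ?M \<longleftrightarrow> ?r \<le> t")
proof -
  have herm: "hermitian ?M"
    by (auto simp: hermitian_def forall_2 dot_sigma_def sigma_x_def sigma_y_def sigma_z_def
        mat_def complex_eq_iff)
  have r2: "?r\<^sup>2 = x\<^sup>2 + y\<^sup>2 + z\<^sup>2"
    by (simp add: norm_vec_def L2_set_def sum_3)
  show ?thesis
  proof
    assume "positive_operator ?M"
    then have q: "0 \<le> (t + z) * (a\<^sup>2 + b\<^sup>2) + (t - z) * (c\<^sup>2 + d\<^sup>2)
        + 2 * x * (a * c + b * d) + 2 * y * (a * d - b * c)" for a b c d :: real
      unfolding positive_operator_def qubit_quadratic_form
      by (metis complex.sel vector_2)
    have tz: "0 \<le> t + z" "0 \<le> t - z"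
      using q[of 1 0 0 0] q[of 0 0 1 0] by simp_all
    have "x\<^sup>2 + y\<^sup>2 + z\<^sup>2 \<le> t\<^sup>2"
    proof (cases "t = 0")
      case True
      then have "z = 0" using tz by simp
      moreover have "0 \<le> - 2 * (x\<^sup>2 + y\<^sup>2)"
        using q[of 1 0 "-x" "-y"] True \<open>z = 0\<close> by (simp add: power2_eq_square)
      ultimately show ?thesis using True by simp
    next
      case False
      have 1: "0 \<le> (t - z) * (t\<^sup>2 - z\<^sup>2 - x\<^sup>2 - y\<^sup>2)"
        using q[of "t - z" 0 "-x" "-y"] by (simp add: power2_eq_square algebra_simps)
      have 2: "0 \<le> (t + z) * (t\<^sup>2 - z\<^sup>2 - x\<^sup>2 - y\<^sup>2)"
        using q[of "-x" "y" "t + z" 0] by (simp add: power2_eq_square algebra_simps)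
      have "0 \<le> (2 * t) * (t\<^sup>2 - z\<^sup>2 - x\<^sup>2 - y\<^sup>2)"
        using add_mono[OF 1 2] by (simp add: algebra_simps)
      moreover have "0 < 2 * t" using tz False by linarith
      ultimately have "0 \<le> t\<^sup>2 - z\<^sup>2 - x\<^sup>2 - y\<^sup>2"
        using zero_le_mult_iff by (metis not_less)
      then show ?thesis by simp
    qed
    then have "?r\<^sup>2 \<le> t\<^sup>2" using r2 by simp
    moreover have "0 \<le> t" using tz by linarith
    ultimately show "?r \<le> t" by (rule power2_le_imp_le)
  next
    assume le: "?r \<le> t"
    have "0 \<le> (t + z) * (a\<^sup>2 + b\<^sup>2) + (t - z) * (c\<^sup>2 + d\<^sup>2)
        + 2 * x * (a * c + b * d) + 2 * y * (a * d - b * c)" for a b c d :: real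
    proof -
      define u :: "real^3" where
        "u = vector [2 * (a * c + b * d), 2 * (a * d - b * c), a\<^sup>2 + b\<^sup>2 - c\<^sup>2 - d\<^sup>2]"
      have "norm u = sqrt ((a\<^sup>2 + b\<^sup>2 + c\<^sup>2 + d\<^sup>2)\<^sup>2)"
        by (simp add: u_def norm_vec_def L2_set_def sum_3 power2_eq_square algebra_simps)
      then have nu: "norm u = a\<^sup>2 + b\<^sup>2 + c\<^sup>2 + d\<^sup>2"
        by simp
      have "\<bar>vector [x, y, z] \<bullet> u\<bar> \<le> ?r * norm u"
        by (rule Cauchy_Schwarz_ineq2)
      also have "\<dots> \<le> t * norm u"
        using le by (simp add: mult_right_mono)
      finally have "0 \<le> t * norm u + vector [x, y, z] \<bullet> u"
        by linarith
      then show ?thesis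
        unfolding nu by (simp add: u_def inner_vec_def sum_3 algebra_simps)
    qed
    then show "positive_operator ?M"
      unfolding positive_operator_def qubit_quadratic_form using herm by blast
  qed
qed

lemma binary_qubit_povm_effects:
  "binary_qubit_povm A \<longleftrightarrow>
     positive_operator ((1/2) *\<^sub>R (mat 1 + A)) \<and> positive_operator ((1/2) *\<^sub>R (mat 1 - A))"
proof -
  have plus: "positive_operator ((1/2) *\<^sub>R (mat 1 + A)) \<longleftrightarrow> norm (vector [x, y, z] :: real^3) \<le> 1 + t"
    and minus: "positive_operator ((1/2) *\<^sub>R (mat 1 - A)) \<longleftrightarrow> norm (vector [x, y, z] :: real^3) \<le> 1 - t"
    if A: "A = dot_sigma (vector [x, y, z]) + t *\<^sub>R mat 1" for A x y z t
  proof -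
    have n: "norm (vector [x/2, y/2, z/2] :: real^3) = norm (vector [x, y, z] :: real^3) / 2"
      "norm (vector [-x/2, -y/2, -z/2] :: real^3) = norm (vector [x, y, z] :: real^3) / 2"
    proof -
      have "vector [x/2, y/2, z/2] = (1/2) *\<^sub>R (vector [x, y, z] :: real^3)"
        "vector [-x/2, -y/2, -z/2] = (-1/2) *\<^sub>R (vector [x, y, z] :: real^3)"
        by (simp_all add: vec_eq_iff forall_3)
      then show "norm (vector [x/2, y/2, z/2] :: real^3) = norm (vector [x, y, z] :: real^3) / 2"
        "norm (vector [-x/2, -y/2, -z/2] :: real^3) = norm (vector [x, y, z] :: real^3) / 2"
        by (simp_all only: norm_scaleR)
    qed
    have "(1/2) *\<^sub>R (mat 1 + A) = dot_sigma (vector [x/2, y/2, z/2]) + ((1 + t)/2) *\<^sub>R mat 1"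
      by (auto simp: A vec_eq_iff forall_2 dot_sigma_def sigma_x_def sigma_y_def sigma_z_def
          mat_def complex_eq_iff field_simps)
    then show "positive_operator ((1/2) *\<^sub>R (mat 1 + A)) \<longleftrightarrow> norm (vector [x, y, z] :: real^3) \<le> 1 + t"
      using positive_operator_qubit_iff[of "x/2" "y/2" "z/2" "(1 + t)/2"] n by simp
    have "(1/2) *\<^sub>R (mat 1 - A) = dot_sigma (vector [-x/2, -y/2, -z/2]) + ((1 - t)/2) *\<^sub>R mat 1"
      by (auto simp: A vec_eq_iff forall_2 dot_sigma_def sigma_x_def sigma_y_def sigma_z_def
          mat_def complex_eq_iff field_simps)
    then show "positive_operator ((1/2) *\<^sub>R (mat 1 - A)) \<longleftrightarrow> norm (vector [x, y, z] :: real^3) \<le> 1 - t"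
      using positive_operator_qubit_iff[of "-x/2" "-y/2" "-z/2" "(1 - t)/2"] n by simp
  qed
  show ?thesis
  proof
    assume "binary_qubit_povm A"
    then obtain s' s :: real and a :: "real^3" where A: "A = s' *\<^sub>R dot_sigma a + s *\<^sub>R mat 1"
      and p: "norm a = 1" "0 \<le> s'" "s' + \<bar>s\<bar> \<le> 1"
      unfolding binary_qubit_povm_def by blast
    have v: "vector [s' * a $ 1, s' * a $ 2, s' * a $ 3] = s' *\<^sub>R a"
      by (simp add: vec_eq_iff forall_3)
    have "A = dot_sigma (vector [s' * a $ 1, s' * a $ 2, s' * a $ 3]) + s *\<^sub>R mat 1"
      unfolding A by (simp add: dot_sigma_def scaleR_add_right)
    from plus[OF this] minus[OF this] p
    show "positive_operator ((1/2) *\<^sub>R (mat 1 + A)) \<and> positive_operator ((1/2) *\<^sub>R (mat 1 - A))"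
      by (auto simp: v)
  next
    assume pos: "positive_operator ((1/2) *\<^sub>R (mat 1 + A)) \<and> positive_operator ((1/2) *\<^sub>R (mat 1 - A))"
    then have hp: "hermitian ((1/2) *\<^sub>R (mat 1 + A))"
      by (simp add: positive_operator_def)
    have "hermitian A"
      unfolding hermitian_def
    proof (intro allI)
      fix i j
      have "(1/2) *\<^sub>R (mat 1 + A) $ i $ j = cnj ((1/2) *\<^sub>R (mat 1 + A) $ j $ i)"
        using hp unfolding hermitian_def by auto
      moreover have "(mat 1 :: complex^2^2) $ i $ j = cnj (mat 1 $ j $ i)"
        by (simp add: mat_def)
      ultimately show "A $ i $ j = cnj (A $ j $ i)"
        by simp
    qed
    then obtain t x y z where A: "A = dot_sigma (vector [x, y, z]) + t *\<^sub>R mat 1"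
      using hermitian_qubit_decomposition by blast
    define w where "w = (vector [x, y, z] :: real^3)"
    have le: "norm w \<le> 1 + t" "norm w \<le> 1 - t"
      using plus[OF A] minus[OF A] pos by (auto simp: w_def)
    define a where "a = (if w = 0 then axis 1 1 else (1 / norm w) *\<^sub>R w)"
    have na: "norm a = 1"
      by (simp add: a_def)
    have w: "norm w *\<^sub>R a = w"
      by (simp add: a_def)
    have "norm w *\<^sub>R dot_sigma a = dot_sigma (norm w *\<^sub>R a)"
      by (simp add: dot_sigma_def scaleR_add_right)
    then have "A = norm w *\<^sub>R dot_sigma a + t *\<^sub>R mat 1"
      using A w w_def by simp
    moreover have "0 \<le> norm w" by simp
    moreover have "norm w \<le> 1" "-1 \<le> t" "t \<le> 1" "norm w + \<bar>t\<bar> \<le> 1"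
      using le norm_ge_zero[of w] by linarith+
    ultimately show "binary_qubit_povm A"
      unfolding binary_qubit_povm_def using na by blast
  qed
qed

end

(* Take r_l = s_l and write p_l = s'_l a_l. For a state with Bloch vector n (|n| <= 1) one has
   A_l - r_l = <p_l, n> and |p_l| <= 1 - |r_l|. The Cauchy-Schwarz inequality for the positive
   semidefinite form <p, q> - <p, n> <q, n> then shows that the number <p_i, p_j>, which does not
   depend on the state, lies above every g_- and below every g_+. *)
theory Submission
  imports Defs
begin

text \<open>For a unit vector \<open>n\<close> this is Cauchy-Schwarz for the components of
  \<open>p\<close> and \<open>q\<close> orthogonal to \<open>n\<close>. A shorter \<open>n\<close>
  is first lifted to a unit vector.\<close>

lemma Cauchy_Schwarz_orthogonal_part:
  fixes p q n :: "'a::real_inner"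
  assumes "norm n \<le> 1"
  shows "\<bar>p \<bullet> q - (p \<bullet> n) * (q \<bullet> n)\<bar>
    \<le> sqrt ((norm p)\<^sup>2 - (p \<bullet> n)\<^sup>2) * sqrt ((norm q)\<^sup>2 - (q \<bullet> n)\<^sup>2)"
proof -
  \<comment> \<open>An extra coordinate makes \<open>n\<close> a unit vector without changing its products with \<open>p\<close> and \<open>q\<close>.\<close>
  define m :: "'a \<times> real" where "m = (n, sqrt (1 - (norm n)\<^sup>2))"
  define perp where "perp v = (v, 0) - (v \<bullet> n) *\<^sub>R m" for v
  have "(norm n)\<^sup>2 \<le> 1"
    using assms by (simp add: power_le_one)
  then have m: "m \<bullet> m = 1"
    by (simp add: m_def power2_norm_eq_inner flip: power2_eq_square)
  have vm: "(v, 0) \<bullet> m = v \<bullet> n" "m \<bullet> (v, 0) = v \<bullet> n" for v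
    by (simp_all add: m_def inner_commute)
  have inner_perp: "perp v \<bullet> perp w = v \<bullet> w - (v \<bullet> n) * (w \<bullet> n)" for v w
    by (simp add: perp_def inner_diff_left inner_diff_right m vm)
  have norm_perp: "norm (perp v) = sqrt ((norm v)\<^sup>2 - (v \<bullet> n)\<^sup>2)" for v
    unfolding norm_eq_sqrt_inner[of "perp v"] inner_perp
    by (simp add: power2_norm_eq_inner flip: power2_eq_square)
  show ?thesis
    using Cauchy_Schwarz_ineq2[of "perp p" "perp q"] by (simp only: inner_perp norm_perp)
qed

text \<open>The Pauli matrices are traceless, square to the identity and have traceless pairwise
  products, so only products of equal basis elements contribute, each with trace 2.\<close>

lemma Re_trace_dot_sigma:
  "Re (trace ((dot_sigma w + t *\<^sub>R mat 1) ** (dot_sigma a + s *\<^sub>R mat 1))) = 2 * (a \<bullet> w + t * s)"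
  by (simp add: trace_def sum_2 sum_3 inner_vec_def matrix_matrix_mult_def dot_sigma_def
      sigma_x_def sigma_y_def sigma_z_def mat_def algebra_simps)

text \<open>The Bloch vector: unit trace fixes the identity coefficient at 1/2, and positivity
  bounds the vector of Pauli coefficients by 1/2. One \<open>n\<close> serves all \<open>a\<close>
  and \<open>s\<close>, hence both observables at once.\<close>

lemma density_matrix_Bloch:
  fixes \<rho> :: "complex^2^2"
  assumes "density_matrix \<rho>"
  obtains n :: "real^3" where "norm n \<le> 1"
    and "\<And>a s. expectation \<rho> (dot_sigma a + s *\<^sub>R mat 1) = a \<bullet> n + s"
proof -
  have pos: "positive_operator \<rho>" and tr: "trace \<rho> = 1"
    using assms by (simp_all add: density_matrix_def)
  then obtain t x y z where \<rho>: "\<rho> = dot_sigma (vector [x, y, z]) + t *\<^sub>R mat 1"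
    using hermitian_qubit_decomposition positive_operator_def by blast
  have "Re (trace \<rho>) = 2 * t"
    by (simp add: \<rho> trace_def sum_2 dot_sigma_def sigma_x_def sigma_y_def sigma_z_def mat_def)
  then have t: "t = 1 / 2"
    using tr by simp
  \<comment> \<open>Doubling absorbs the factor 2 of the trace formula.\<close>
  define n :: "real^3" where "n = 2 *\<^sub>R vector [x, y, z]"
  have "norm (vector [x, y, z] :: real^3) \<le> 1 / 2"
    using pos positive_operator_qubit_iff[of x y z t] unfolding \<rho> t by simp
  then have "norm n \<le> 1"
    by (simp add: n_def)
  moreover have "expectation \<rho> (dot_sigma a + s *\<^sub>R mat 1) = a \<bullet> n + s" for a s
    unfolding expectation_def \<rho> Re_trace_dot_sigma by (simp add: n_def t)
  ultimately show thesis
    using that by blast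
qed

text \<open>Absorbing the sharpness \<open>s'\<close> into the direction gives a vector
  \<open>p\<close> of norm \<open>s'\<close>.\<close>

lemma binary_qubit_povm_vector:
  assumes "binary_qubit_povm A"
  obtains p :: "real^3" and s :: real
  where "A = dot_sigma p + s *\<^sub>R mat 1" and "norm p \<le> 1 - \<bar>s\<bar>"
proof -
  obtain s' s :: real and a :: "real^3" where A: "A = s' *\<^sub>R dot_sigma a + s *\<^sub>R mat 1"
    and "norm a = 1" "0 \<le> s'" "s' + \<bar>s\<bar> \<le> 1"
    using assms unfolding binary_qubit_povm_def by blast
  moreover have "s' *\<^sub>R dot_sigma a = dot_sigma (s' *\<^sub>R a)"
    by (simp add: dot_sigma_def scaleR_add_right)
  ultimately show thesis
    using that[of "s' *\<^sub>R a" s] by simp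
qed

text \<open>Makes the radicands nonnegative, both for \<open>b\<close> the radius 1 - |r| and for
  \<open>b = norm p\<close>.\<close>

lemma inner_square_le:
  fixes p n :: "'a::real_inner"
  assumes "norm n \<le> 1" "norm p \<le> b"
  shows "(p \<bullet> n)\<^sup>2 \<le> b\<^sup>2"
proof -
  have "\<bar>p \<bullet> n\<bar> \<le> b"
    using Cauchy_Schwarz_ineq2[of p n] mult_left_le[OF assms(1) norm_ge_zero[of p]] assms(2)
    by linarith
  then show ?thesis
    using power_mono[of "\<bar>p \<bullet> n\<bar>" b 2] by simp
qed

text \<open>The shifts cancel, so both claims are the two sides of one absolute value bound.
  Enlarging the norms to \<open>bi\<close> and \<open>bj\<close> only weakens it.\<close>

lemma g_minus_le_inner_le_g_plus:
  fixes p q n :: "'a::real_inner"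
  assumes n: "norm n \<le> 1" and p: "norm p \<le> bi" and q: "norm q \<le> bj"
  shows "g_minus ri rj bi bj (p \<bullet> n + ri) (q \<bullet> n + rj) \<le> p \<bullet> q"
    and "p \<bullet> q \<le> g_plus ri rj bi bj (p \<bullet> n + ri) (q \<bullet> n + rj)"
proof -
  \<comment> \<open>Multiplying the two root inequalities below requires nonnegative
    factors.\<close>
  have nonneg: "0 \<le> (norm v)\<^sup>2 - (v \<bullet> n)\<^sup>2" for v
    using inner_square_le[OF n order_refl] by simp
  have "(norm p)\<^sup>2 \<le> bi\<^sup>2" "(norm q)\<^sup>2 \<le> bj\<^sup>2"
    using p q by (simp_all add: power_mono)
  then have "sqrt ((norm p)\<^sup>2 - (p \<bullet> n)\<^sup>2) * sqrt ((norm q)\<^sup>2 - (q \<bullet> n)\<^sup>2)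
      \<le> sqrt (bi\<^sup>2 - (p \<bullet> n)\<^sup>2) * sqrt (bj\<^sup>2 - (q \<bullet> n)\<^sup>2)"
    using nonneg[of p] nonneg[of q] by (intro mult_mono real_sqrt_le_mono) auto
  with Cauchy_Schwarz_orthogonal_part[OF n, of p q]
  have "\<bar>p \<bullet> q - (p \<bullet> n) * (q \<bullet> n)\<bar> \<le> sqrt (bi\<^sup>2 - (p \<bullet> n)\<^sup>2) * sqrt (bj\<^sup>2 - (q \<bullet> n)\<^sup>2)"
    by linarith
  then show "g_minus ri rj bi bj (p \<bullet> n + ri) (q \<bullet> n + rj) \<le> p \<bullet> q"
    and "p \<bullet> q \<le> g_plus ri rj bi bj (p \<bullet> n + ri) (q \<bullet> n + rj)"
    unfolding g_minus_def g_plus_def by (simp_all add: abs_le_iff)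
qed

theorem theorem2:
  fixes \<Omega> :: "(complex^2^2) set" and Ai Aj :: "complex^2^2"
  assumes "finite \<Omega>" and "\<Omega> \<noteq> {}"
    and "\<And>\<rho>. \<rho> \<in> \<Omega> \<Longrightarrow> density_matrix \<rho>"
    and "binary_qubit_povm Ai" and "binary_qubit_povm Aj"
  shows "\<exists>ri rj :: real. -1 \<le> ri \<and> ri \<le> 1 \<and> -1 \<le> rj \<and> rj \<le> 1 \<and>
    (let bi = 1 - \<bar>ri\<bar>; bj = 1 - \<bar>rj\<bar> in
      (\<forall>\<rho>\<in>\<Omega>. bi\<^sup>2 - (expectation \<rho> Ai - ri)\<^sup>2 \<ge> 0 \<and> bj\<^sup>2 - (expectation \<rho> Aj - rj)\<^sup>2 \<ge> 0) \<and>
      Max ((\<lambda>\<rho>. g_minus ri rj bi bj (expectation \<rho> Ai) (expectation \<rho> Aj)) ` \<Omega>)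
        \<le> Min ((\<lambda>\<rho>. g_plus ri rj bi bj (expectation \<rho> Ai) (expectation \<rho> Aj)) ` \<Omega>))"
proof -
  obtain p ri where Ai: "Ai = dot_sigma p + ri *\<^sub>R mat 1" and p: "norm p \<le> 1 - \<bar>ri\<bar>"
    using assms(4) by (rule binary_qubit_povm_vector)
  obtain q rj where Aj: "Aj = dot_sigma q + rj *\<^sub>R mat 1" and q: "norm q \<le> 1 - \<bar>rj\<bar>"
    using assms(5) by (rule binary_qubit_povm_vector)
  define bi bj where "bi = 1 - \<bar>ri\<bar>" and "bj = 1 - \<bar>rj\<bar>"
  note b = p[folded bi_def] q[folded bj_def]
  have state: "0 \<le> bi\<^sup>2 - (expectation \<rho> Ai - ri)\<^sup>2 \<and> 0 \<le> bj\<^sup>2 - (expectation \<rho> Aj - rj)\<^sup>2 \<and>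
      g_minus ri rj bi bj (expectation \<rho> Ai) (expectation \<rho> Aj) \<le> p \<bullet> q \<and>
      p \<bullet> q \<le> g_plus ri rj bi bj (expectation \<rho> Ai) (expectation \<rho> Aj)" if "\<rho> \<in> \<Omega>" for \<rho>
  proof -
    obtain n :: "real^3" where n: "norm n \<le> 1"
      and E: "\<And>a s. expectation \<rho> (dot_sigma a + s *\<^sub>R mat 1) = a \<bullet> n + s"
      using assms(3)[OF \<open>\<rho> \<in> \<Omega>\<close>] by (rule density_matrix_Bloch) blast
    show ?thesis
      unfolding Ai Aj E
      using inner_square_le[OF n b(1)] inner_square_le[OF n b(2)] g_minus_le_inner_le_g_plus[OF n b]
      by simp
  qed
  \<comment> \<open>As \<Omega> is finite and nonempty, bounds valid for every state pass to the
    extrema.\<close>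
  have "Max ((\<lambda>\<rho>. g_minus ri rj bi bj (expectation \<rho> Ai) (expectation \<rho> Aj)) ` \<Omega>) \<le> p \<bullet> q"
    using assms(1,2) state by simp
  also have "p \<bullet> q \<le> Min ((\<lambda>\<rho>. g_plus ri rj bi bj (expectation \<rho> Ai) (expectation \<rho> Aj)) ` \<Omega>)"
    using assms(1,2) state by simp
  finally have sep: "Max ((\<lambda>\<rho>. g_minus ri rj bi bj (expectation \<rho> Ai) (expectation \<rho> Aj)) ` \<Omega>)
      \<le> Min ((\<lambda>\<rho>. g_plus ri rj bi bj (expectation \<rho> Ai) (expectation \<rho> Aj)) ` \<Omega>)" .
  \<comment> \<open>The radii dominate norms, so they are nonnegative.\<close>
  have "\<bar>ri\<bar> \<le> 1" "\<bar>rj\<bar> \<le> 1"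
    using p q norm_ge_zero[of p] norm_ge_zero[of q] by linarith+
  then show ?thesis
    using state sep unfolding Let_def bi_def bj_def
    by (intro exI[of _ ri] exI[of _ rj]) (simp add: abs_le_iff)
qed

end
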